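(* Let $U\colon\mathbb{R}^d\to\mathbb{R}$ satisfy the standing assumptions, the logarithmic Sobolev assumption and the technical regularity assumption listed in the context, and let $a_0$, $L$, $U^*$, $\mu^a$, $C$ be as defined there. Let $\varepsilon\in(0,1/2)$ and $\delta\in(0,1)$, and suppose that the real number $a$ and the positive integer $N$ satisfy $$a\ge\max\left(a_0,\frac{9C^4L^2}{\varepsilon^2}\right)\qquad\text{and}\qquad N\ge\frac{18\ln(1/\delta)}{\varepsilon^2}.$$ Let $\tilde\mu$ be a probability measure on $\mathbb{R}^d$ such that $$\mathrm{KL}(\tilde\mu\,\|\,\mu^a)\le\frac{\varepsilon^2}{18}.$$ Let $\tilde X^{(1)},\dots,\tilde X^{(N)}$ be i.i.d. random variables with law $\tilde\mu$, and set $\tilde X=\tilde X^{(I)}$, where $I\in\operatorname{argmin}_{i=1,\dots,N}U(\tilde X^{(i)})$. Then $$\Pr\big(U(\tilde X)-U^*\ge\varepsilon\big)\le\delta.$$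
   Context: Standing assumptions on $U\colon\mathbb{R}^d\to\mathbb{R}$: (i) $U$ is twice differentiable, $L$-smooth (i.e. $\nabla U$ is $L$-Lipschitz), and its Hessian is Lipschitz continuous and bounded; (ii) there is $a_0>0$ such that $\exp(-a_0U)$ is integrable on $\mathbb{R}^d$; (iii) $U$ has a nonzero finite number of global minimizers and no global minimizers at infinity (i.e. there is no sequence $x_n$ with $\|x_n\|\to\infty$ and $U(x_n)\to\inf U$). The minimal value of $U$ is denoted $U^*$. For $a\ge a_0$, $\mu^a$ denotes the probability measure on $\mathbb{R}^d$ with density proportional to $\exp(-aU(x))$. For probability measures $\mu,\nu$ with densities, $\mathrm{KL}(\mu\|\nu)=\mathbb{E}_{X\sim\mu}[\log(\mu(X)/\nu(X))]$ and $\mathrm{Fi}(\mu\|\nu)=\mathbb{E}_{X\sim\mu}[\|\nabla\log(\mu(X)/\nu(X))\|^2]$ (measures and their densities are denoted by the same symbol). A measure $\mu$ satisfies a logarithmic Sobolev inequality with coefficient $\rho>0$ if $\mathrm{KL}(\nu\|\mu)\le\frac{1}{2\rho}\mathrm{Fi}(\nu\|\mu)$ for all probability measures $\nu$. Logarithmic Sobolev assumption: for every $a\ge a_0$, $\mu^a$ satisfies a logarithmic Sobolev inequality with some coefficient $\rho_a>0$. Technical regularity assumption: (1) there is a global minimizer $\hat x$ of $U$ with $\int_{\mathbb{R}^d}\|x-\hat x\|^2\exp(-U(x))\,dx<+\infty$; (2) $U$ is $6$ times continuously differentiable on a set $F\subset\mathbb{R}^d$ whose interior contains all global minimizers of $U$;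 (3) the Hessian of $U$ is positive definite at each global minimizer. Let $\mu^*$ be the probability measure supported on the finite set of global minimizers of $U$ giving each global minimizer $x_i$ a weight proportional to $\det(\nabla^2U(x_i))^{-1/2}$. Let $W_2$ denote the Wasserstein-2 distance. If $U$ is twice differentiable with $L$-Lipschitz gradient and Lipschitz continuous and bounded Hessian, $\exp(-a_0U)$ is integrable on $\mathbb{R}^d$, $U$ has a nonzero finite number of global minimizers and no global minimizers at infinity, $\mu^a$ satisfies a logarithmic Sobolev inequality with some coefficient $\rho_a>0$ for every $a\ge a_0$, $\int_{\mathbb{R}^d}\|x-\hat x\|^2\exp(-U(x))\,dx<+\infty$ for some global minimizer $\hat x$ of $U$, $U$ is $6$ times continuously differentiable on a set $F\subset\mathbb{R}^d$ whose interior contains all global minimizers of $U$, and the Hessian of $U$ is positive definite at each global minimizer, then it is known that there is a constant $C>0$ depending only on $U$ such that $W_2(\mu^a,\mu^* )\le C\,a^{-1/4}$ for all $a\ge a_0$; $C$ denotes such a constant. *)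

theory Defs
  imports "HOL-Probability.Probability"
begin

definition grad :: "('a::real_inner \<Rightarrow> real) \<Rightarrow> 'a \<Rightarrow> 'a" where
  "grad f x = (THE D. GDERIV f x :> D)"

definition hess :: "(real^'n \<Rightarrow> real) \<Rightarrow> real^'n \<Rightarrow> real^'n^'n" where
  "hess f x = jacobian (grad f) (at x)"

definition pos_def :: "real^'n^'n \<Rightarrow> bool" where
  "pos_def A \<longleftrightarrow> (\<forall>v. v \<noteq> 0 \<longrightarrow> v \<bullet> (A *v v) > 0)"

text \<open>Derivatives are taken within \<open>S\<close>, so that \<open>S\<close> need not be open; at interior
  points of \<open>S\<close> they are the ordinary ones.\<close>

primrec Ck_on :: "nat \<Rightarrow> (real^'n \<Rightarrow> real) \<Rightarrow> (real^'n) set \<Rightarrow> bool" where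
  "Ck_on 0 f S \<longleftrightarrow> continuous_on S f"
| "Ck_on (Suc k) f S \<longleftrightarrow>
     (\<exists>g. (\<forall>x\<in>S. (f has_derivative (\<lambda>h. g x \<bullet> h)) (at x within S)) \<and>
          (\<forall>i. Ck_on k (\<lambda>x. g x $ i) S))"

definition minimizers :: "('a \<Rightarrow> real) \<Rightarrow> 'a set" where
  "minimizers U = {x. \<forall>y. U x \<le> U y}"

definition gibbs :: "('a::euclidean_space \<Rightarrow> real) \<Rightarrow> real \<Rightarrow> 'a measure" where
  "gibbs U a = density lborel
     (\<lambda>x. ennreal (exp (- a * U x) / (LINT y|lborel. exp (- a * U y))))"

definition limit_gibbs :: "(real^'n \<Rightarrow> real) \<Rightarrow> (real^'n) measure" where
  "limit_gibbs U =
     (let w = (\<lambda>x. det (hess U x) powr (-1/2))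
      in distr (point_measure (minimizers U)
                  (\<lambda>x. ennreal (w x / (\<Sum>y\<in>minimizers U. w y)))) borel (\<lambda>x. x))"

text \<open>\<open>KL \<mu> \<nu>\<close> is the divergence of \<open>\<mu>\<close> from the reference measure \<open>\<nu>\<close>; the arguments of
  \<^const>\<open>KL_divergence\<close> come in the opposite order, and that function returns junk values
  instead of infinity if the density does not exist or the integral diverges. The negative
  part of the integrand is always integrable, so non-integrability means divergence to
  infinity.\<close>

definition KL :: "'a measure \<Rightarrow> 'a measure \<Rightarrow> ereal" where
  "KL \<mu> \<nu> =
     (if absolutely_continuous \<nu> \<mu> \<and> integrable \<mu> (entropy_density (exp 1) \<nu> \<mu>)
      then ereal (KL_divergence (exp 1) \<nu> \<mu>) else \<infinity>)"

definition differentiable_density :: "'a::euclidean_space measure \<Rightarrow> ('a \<Rightarrow> real) \<Rightarrow> bool" where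
  "differentiable_density \<mu> p \<longleftrightarrow>
     (\<forall>x. 0 \<le> p x) \<and> (\<forall>x. p differentiable (at x)) \<and> \<mu> = density lborel (\<lambda>x. ennreal (p x))"

text \<open>A continuous Lebesgue density is unique, so the infimum ranges over at most one element;
  it is infinite if one of the measures has no differentiable density. A gradient taken merely
  almost everywhere would not do: for \<open>\<mu>\<close> equal to \<open>\<nu>\<close> conditioned on a half-space it would
  vanish although \<open>\<mu> \<noteq> \<nu>\<close>, so no logarithmic Sobolev inequality could hold. The points where
  \<open>p\<close> or \<open>q\<close> is zero form a \<open>\<mu>\<close>-null set.\<close>

definition fisher :: "'a::euclidean_space measure \<Rightarrow> 'a measure \<Rightarrow> ereal" where
  "fisher \<mu> \<nu> =
     (if absolutely_continuous \<nu> \<mu>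
      then (INF (p, q) \<in> {(p, q). differentiable_density \<mu> p \<and> differentiable_density \<nu> q}.
              enn2ereal (\<integral>\<^sup>+x. ennreal ((norm (grad (\<lambda>y. ln (p y / q y)) x))\<^sup>2) \<partial>\<mu>))
      else \<infinity>)"

definition log_sobolev :: "'a::euclidean_space measure \<Rightarrow> real \<Rightarrow> bool" where
  "log_sobolev \<mu> \<rho> \<longleftrightarrow>
     (\<forall>\<nu>. prob_space \<nu> \<longrightarrow> sets \<nu> = sets borel \<longrightarrow> KL \<nu> \<mu> \<le> ereal (1 / (2 * \<rho>)) * fisher \<nu> \<mu>)"

definition couplings :: "'a::euclidean_space measure \<Rightarrow> 'a measure \<Rightarrow> ('a \<times> 'a) measure set" where
  "couplings \<mu> \<nu> = {\<pi>. prob_space \<pi> \<and> sets \<pi> = sets (borel \<Otimes>\<^sub>M borel) \<and>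
                      distr \<pi> borel fst = \<mu> \<and> distr \<pi> borel snd = \<nu>}"

definition wasserstein2 :: "'a::euclidean_space measure \<Rightarrow> 'a measure \<Rightarrow> ennreal" where
  "wasserstein2 \<mu> \<nu> =
     (let c = (INF \<pi>\<in>couplings \<mu> \<nu>. \<integral>\<^sup>+z. ennreal ((dist (fst z) (snd z))\<^sup>2) \<partial>\<pi>)
      in if c = \<infinity> then \<infinity> else ennreal (sqrt (enn2real c)))"

end

theory Submission
  imports Defs
begin

text \<open>
  Let \<open>p\<close> be the mass that \<open>\<mu>t\<close> gives to the bad set \<open>A = {x. \<epsilon> \<le> U x - U*}\<close>. The best of
  \<open>N\<close> samples is bad exactly when all of them are (\<open>prob_argmin_ge\<close>), so the probability in
  question equals \<open>p ^ N\<close>. Since \<open>p ^ N \<le> exp (- (1 - p) * N)\<close>, the condition on \<open>N\<close> leaves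
  only the crude estimate \<open>1 - p \<ge> \<epsilon>\<^sup>2 / 18\<close> to be shown (\<open>geometric_decay\<close>).

  The mass \<open>q\<close> of \<open>A\<close> under the Gibbs measure is controlled by transport. As the gradient
  vanishes at minimizers and is \<open>L\<close>-Lipschitz, \<open>U x - U* \<le> L / 2 * (dist x z)\<^sup>2\<close> for every minimizer
  \<open>z\<close>; and the limit measure lives on minimizers, so integrating over a coupling shows that the
  Gibbs mean of \<open>U - U*\<close> is at most \<open>L / 2 * W\<^sub>2\<^sup>2 \<le> L * C\<^sup>2 / (2 * sqrt a)\<close>. Markov's
  inequality and the lower bound on \<open>a\<close> give \<open>q \<le> 1 / 6\<close> (\<open>suboptimality_transport_bound\<close>).

  To pass from the Gibbs measure to \<open>\<mu>t\<close> one would usually invoke Pinsker's inequality. The large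
  slack in the requirement on \<open>p\<close> allows something more elementary: testing the variational
  characterisation of the divergence with the indicator function of \<open>A\<close> gives
  \<open>p \<le> KL + (exp 1 - 1) * q\<close> (\<open>KL_event_bound\<close>). Hence \<open>p \<le> \<epsilon>\<^sup>2 / 18 + 1 / 3\<close>, which suffices
  because \<open>\<epsilon> < 1 / 2\<close>.
\<close>

section \<open>A quadratic upper bound around minimizers\<close>

lemma GDERIV_grad:
  fixes f :: "'a::euclidean_space \<Rightarrow> real"
  assumes "f differentiable (at x)"
  shows "GDERIV f x :> grad f x"
proof -
  obtain D where D: "(f has_derivative D) (at x)"
    using assms by (auto simp: differentiable_def)
  interpret bounded_linear D using D by (rule has_derivative_bounded_linear)
  define d where "d = adjoint D 1"
  have "D = (\<lambda>h. h \<bullet> d)"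
    using adjoint_works[OF linear_axioms, of _ 1] by (auto simp: d_def fun_eq_iff)
  then have "GDERIV f x :> d"
    using D by (simp add: gderiv_def)
  moreover have "e = d" if "GDERIV f x :> e" for e
  proof -
    have "(\<lambda>h. h \<bullet> e) = (\<lambda>h. h \<bullet> d)"
      using that \<open>GDERIV f x :> d\<close> unfolding gderiv_def by (rule has_derivative_unique)
    then show ?thesis
      using vector_eq_ldot[of e d] by (simp add: fun_eq_iff)
  qed
  ultimately show ?thesis
    unfolding grad_def by (rule theI)
qed

lemma grad_minimizer:
  fixes f :: "'a::euclidean_space \<Rightarrow> real"
  assumes "f differentiable (at z)" "z \<in> minimizers f"
  shows "grad f z = 0"
proof -
  have "(f has_derivative (\<lambda>h. h \<bullet> grad f z)) (at z)"
    using GDERIV_grad[OF assms(1)] by (simp add: gderiv_def)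
  then have "(\<lambda>h. h \<bullet> grad f z) = (\<lambda>h. 0)"
    using assms(2) by (intro differential_zero_maxmin[of z UNIV]) (auto simp: minimizers_def)
  then have "grad f z \<bullet> grad f z = 0"
    by (rule fun_cong)
  then show ?thesis by simp
qed

text \<open>Along the segment from \<open>z\<close> to \<open>x\<close> the slope of \<open>f\<close> starts at zero and grows at rate at
  most \<open>L\<close> times the squared length, so subtracting the corresponding parabola leaves a
  nonincreasing function.\<close>

lemma minimizer_quadratic_bound:
  fixes f :: "'a::euclidean_space \<Rightarrow> real"
  assumes f: "\<And>x. f differentiable (at x)" and L: "L-lipschitz_on UNIV (grad f)"
    and z: "z \<in> minimizers f"
  shows "f x - f z \<le> L / 2 * (dist x z)\<^sup>2"
proof -
  define v where "v = x - z"
  define \<phi> where "\<phi> t = f (z + t *\<^sub>R v) - L / 2 * t\<^sup>2 * (norm v)\<^sup>2" for t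
  have "\<phi> 1 \<le> \<phi> 0"
  proof (rule DERIV_nonpos_imp_nonincreasing[of 0 1])
    fix t :: real assume t: "0 \<le> t" "t \<le> 1"
    let ?g = "grad f (z + t *\<^sub>R v)"
    have "(f has_derivative (\<lambda>h. h \<bullet> ?g)) (at (z + t *\<^sub>R v))"
      using GDERIV_grad[OF f] by (simp add: gderiv_def)
    then have "((\<lambda>t. f (z + t *\<^sub>R v)) has_derivative (\<lambda>s. (s *\<^sub>R v) \<bullet> ?g)) (at t)"
      by (rule has_derivative_compose[rotated]) (auto intro!: derivative_eq_intros)
    then have "DERIV (\<lambda>t. f (z + t *\<^sub>R v)) t :> v \<bullet> ?g"
      by (simp add: has_field_derivative_def mult.commute[of _ "v \<bullet> ?g"])
    then have D: "DERIV \<phi> t :> v \<bullet> ?g - L * t * (norm v)\<^sup>2"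
      unfolding \<phi>_def by (auto intro!: derivative_eq_intros)
    have "norm ?g = dist ?g (grad f z)"
      using grad_minimizer[OF f z] by (simp add: dist_norm)
    also have "\<dots> \<le> L * dist (z + t *\<^sub>R v) z"
      using L by (rule lipschitz_onD) auto
    also have "\<dots> = L * t * norm v"
      using t by (simp add: dist_norm)
    finally have "norm v * norm ?g \<le> norm v * (L * t * norm v)"
      by (intro mult_left_mono) auto
    with norm_cauchy_schwarz[of v ?g] have "v \<bullet> ?g - L * t * (norm v)\<^sup>2 \<le> 0"
      by (simp add: power2_eq_square algebra_simps)
    with D show "\<exists>y. DERIV \<phi> t :> y \<and> y \<le> 0"
      by blast
  qed simp
  then show ?thesis
    by (simp add: \<phi>_def v_def dist_norm)
qed

section \<open>Transport to a measure on the minimizers\<close>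

lemma AE_limit_gibbs_minimizers:
  assumes "finite (minimizers U)"
  shows "AE x in limit_gibbs U. x \<in> minimizers U"
proof -
  have "minimizers U \<in> sets borel"
    using assms by (intro borel_closed finite_imp_closed)
  then show ?thesis
    unfolding limit_gibbs_def Let_def
    by (subst AE_distr_iff) (auto simp: space_point_measure)
qed

text \<open>The infimum over couplings is not assumed to be attained, hence the arbitrarily small slack
  between \<open>w\<^sup>2\<close> and \<open>r\<close>. A finite bound also rules out that there are no couplings at all.\<close>

lemma wasserstein2_coupling:
  assumes "wasserstein2 \<mu> \<nu> \<le> ennreal w" "0 \<le> w" "w\<^sup>2 < r"
  obtains \<pi> where "\<pi> \<in> couplings \<mu> \<nu>" "(\<integral>\<^sup>+z. ennreal ((dist (fst z) (snd z))\<^sup>2) \<partial>\<pi>) < ennreal r"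
proof -
  let ?cost = "\<lambda>\<pi>. \<integral>\<^sup>+z. ennreal ((dist (fst z) (snd z))\<^sup>2) \<partial>\<pi>"
  define c where "c = (INF \<pi>\<in>couplings \<mu> \<nu>. ?cost \<pi>)"
  have W: "wasserstein2 \<mu> \<nu> = (if c = \<infinity> then \<infinity> else ennreal (sqrt (enn2real c)))"
    by (simp add: wasserstein2_def c_def)
  have fin: "c \<noteq> \<infinity>"
  proof
    assume "c = \<infinity>"
    with W assms(1) show False by (simp add: top_unique)
  qed
  then have "ennreal (sqrt (enn2real c)) \<le> ennreal w"
    using W assms(1) by simp
  then have "sqrt (enn2real c) \<le> w"
    using assms(2) by (simp add: ennreal_le_iff)
  then have "enn2real c \<le> w\<^sup>2"
    by (rule sqrt_le_D)
  then have "enn2real c < r"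
    using assms(3) by simp
  then have "ennreal (enn2real c) < ennreal r"
    by (subst ennreal_less_iff) auto
  then have "c < ennreal r"
    using fin by (simp add: less_top)
  then show thesis
    using that unfolding c_def INF_less_iff by blast
qed

text \<open>Under a coupling with a measure on the minimizers, the second coordinate serves as the
  minimizer in the quadratic upper bound, so the transport cost dominates the mean
  suboptimality; the rest is Markov's inequality.\<close>

lemma suboptimality_transport_bound:
  fixes f :: "'a::euclidean_space \<Rightarrow> real"
  assumes f: "\<And>x. f differentiable (at x)" and L: "L-lipschitz_on UNIV (grad f)"
    and m: "\<And>z. z \<in> minimizers f \<Longrightarrow> f z = m"
    and \<nu>: "AE x in \<nu>. x \<in> minimizers f"
    and W: "wasserstein2 \<mu> \<nu> \<le> ennreal w" "0 \<le> w"
    and t: "t > 0"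
  shows "measure \<mu> {x. t \<le> f x - m} \<le> L * w\<^sup>2 / (2 * t)"
proof -
  have L0: "0 \<le> L" using L by (rule lipschitz_on_nonneg)
  have cont: "continuous_on UNIV f"
    using f by (auto intro!: continuous_at_imp_continuous_on differentiable_imp_continuous_within)
  then have f_meas [measurable]: "f \<in> borel_measurable borel"
    by (rule borel_measurable_continuous_onI)
  \<comment> \<open>A nearly optimal coupling gives the bound with \<open>r\<close> in place of \<open>w\<^sup>2\<close>;
    let \<open>r\<close> decrease to \<open>w\<^sup>2\<close> afterwards.\<close>
  have bound: "measure \<mu> {x. t \<le> f x - m} \<le> L * r / (2 * t)" if r: "w\<^sup>2 < r" for r
  proof -
    obtain \<pi> where \<pi>: "\<pi> \<in> couplings \<mu> \<nu>"
      and cost: "(\<integral>\<^sup>+z. ennreal ((dist (fst z) (snd z))\<^sup>2) \<partial>\<pi>) < ennreal r"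
      using wasserstein2_coupling[OF W r] .
    then have sets_\<pi> [measurable_cong]: "sets \<pi> = sets (borel \<Otimes>\<^sub>M borel)"
      and fst: "distr \<pi> borel fst = \<mu>" and snd: "distr \<pi> borel snd = \<nu>"
      by (auto simp: couplings_def)
    have r0: "0 \<le> r" using r by (meson zero_le_power2 less_imp_le order_trans)
    have "AE z in \<pi>. snd z \<in> minimizers f"
      using \<nu> unfolding snd[symmetric] by (rule AE_distrD[rotated]) measurable
    then have le: "AE z in \<pi>. ennreal (f (fst z) - m) \<le> ennreal (L / 2) * ennreal ((dist (fst z) (snd z))\<^sup>2)"
    proof eventually_elim
      case (elim z)
      then have "f (fst z) - m \<le> L / 2 * (dist (fst z) (snd z))\<^sup>2"
        using minimizer_quadratic_bound[OF f L] m by metis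
      then show ?case
        using L0 by (simp add: ennreal_mult[symmetric] ennreal_leI)
    qed
    have "(\<integral>\<^sup>+x. ennreal (f x - m) \<partial>\<mu>) = (\<integral>\<^sup>+z. ennreal (f (fst z) - m) \<partial>\<pi>)"
      unfolding fst[symmetric] by (rule nn_integral_distr) measurable
    also have "\<dots> \<le> (\<integral>\<^sup>+z. ennreal (L / 2) * ennreal ((dist (fst z) (snd z))\<^sup>2) \<partial>\<pi>)"
      using le by (rule nn_integral_mono_AE)
    also have "\<dots> = ennreal (L / 2) * (\<integral>\<^sup>+z. ennreal ((dist (fst z) (snd z))\<^sup>2) \<partial>\<pi>)"
      by (rule nn_integral_cmult) measurable
    also have "\<dots> \<le> ennreal (L / 2) * ennreal r"
      using cost by (intro mult_left_mono) auto
    finally have E: "(\<integral>\<^sup>+x. ennreal (f x - m) \<partial>\<mu>) \<le> ennreal (L / 2) * ennreal r" .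
    have sets_\<mu> [measurable_cong]: "sets \<mu> = sets borel" and space_\<mu>: "space \<mu> = UNIV"
      unfolding fst[symmetric] by simp_all
    have "{x. t \<le> f x - m} = {x \<in> UNIV. 1 \<le> ennreal (1 / t) * ennreal (f x - m)}"
    proof -
      have "1 \<le> ennreal (1 / t) * ennreal y \<longleftrightarrow> t \<le> y" for y
      proof (cases "0 \<le> y")
        case True
        then have "1 \<le> ennreal (1 / t) * ennreal y \<longleftrightarrow> ennreal 1 \<le> ennreal (1 / t * y)"
          using t by (simp add: ennreal_mult[symmetric])
        also have "\<dots> \<longleftrightarrow> t \<le> y"
          using t True by (subst ennreal_le_iff) (auto simp: field_simps)
        finally show ?thesis .
      next
        case False
        then show ?thesis using t by (simp add: ennreal_neg)
      qed
      then show ?thesis by simp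
    qed
    then have "emeasure \<mu> {x. t \<le> f x - m} =
        emeasure \<mu> {x \<in> UNIV. 1 \<le> ennreal (1 / t) * ennreal (f x - m)}"
      by simp
    also have "\<dots> \<le> ennreal (1 / t) * (\<integral>\<^sup>+x. ennreal (f x - m) * indicator UNIV x \<partial>\<mu>)"
      using space_\<mu> sets.top[of \<mu>] by (intro nn_integral_Markov_inequality) auto
    also have "\<dots> \<le> ennreal (1 / t) * (ennreal (L / 2) * ennreal r)"
      using E by (intro mult_left_mono) auto
    also have "\<dots> = ennreal (L * r / (2 * t))"
      using t L0 r0 by (simp add: ennreal_mult[symmetric] field_simps)
    finally show ?thesis
      unfolding measure_def using t L0 r0 by (intro enn2real_leI) auto
  qed
  have "((\<lambda>r. L * r / (2 * t)) \<longlongrightarrow> L * w\<^sup>2 / (2 * t)) (at_right (w\<^sup>2))"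
    using t by (intro tendsto_intros) auto
  then show ?thesis
    by (rule tendsto_lowerbound)
       (auto intro!: bound eventually_at_right_less eventually_mono[OF eventually_at_right_less])
qed

section \<open>Change of measure\<close>

text \<open>A linearised Donsker-Varadhan inequality: with \<open>D\<close> the density of \<open>\<mu>\<close> with respect to \<open>\<nu>\<close>,
  integrate the Young inequality \<open>D * g \<le> D * ln D - D + exp g\<close> against \<open>\<nu>\<close>. It is weaker than
  the version with the logarithm of the exponential moment, by \<open>ln y \<le> y - 1\<close>.\<close>

lemma KL_variational_bound:
  assumes "prob_space \<mu>" "prob_space \<nu>" and sets: "sets \<mu> = sets \<nu>"
    and KL: "KL \<mu> \<nu> \<le> ereal k"
    and g: "integrable \<mu> g" and eg: "integrable \<nu> (\<lambda>x. exp (g x))"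
    and g_meas [measurable]: "g \<in> borel_measurable \<nu>"
  shows "(\<integral>x. g x \<partial>\<mu>) \<le> k + (\<integral>x. exp (g x) \<partial>\<nu>) - 1"
proof -
  interpret \<mu>: prob_space \<mu> by fact
  interpret \<nu>: prob_space \<nu> by fact
  let ?h = "entropy_density (exp 1) \<nu> \<mu>"
  define D where "D x = enn2real (RN_deriv \<nu> \<mu> x)" for x
  have ac: "absolutely_continuous \<nu> \<mu>" and h: "integrable \<mu> ?h"
    and k: "(\<integral>x. ?h x \<partial>\<mu>) \<le> k"
    using KL by (auto simp: KL_def KL_divergence_def split: if_splits)
  note RN = \<nu>.RN_deriv_integrable[OF \<mu>.sigma_finite_measure_axioms ac sets]
  note RN' = \<nu>.RN_deriv_integral[OF \<mu>.sigma_finite_measure_axioms ac sets]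
  have h_eq: "?h x = ln (D x)" for x
    by (simp add: entropy_density_def D_def log_def)
  have int: "integrable \<nu> (\<lambda>x. D x * g x)" "integrable \<nu> (\<lambda>x. D x * ?h x)"
      "integrable \<nu> (\<lambda>x. D x * 1)"
    using RN[of g] RN[of ?h] RN[of "\<lambda>_. 1"] g h by (auto simp: D_def)
  have "(\<integral>x. g x \<partial>\<mu>) = (\<integral>x. D x * g x \<partial>\<nu>)"
    using RN'[of g] by (simp add: D_def)
  also have "\<dots> \<le> (\<integral>x. D x * ?h x - D x * 1 + exp (g x) \<partial>\<nu>)"
  proof (rule integral_mono)
    fix x
    show "D x * g x \<le> D x * ?h x - D x * 1 + exp (g x)"
    proof (cases "D x = 0")
      case False
      then have D: "0 < D x" by (simp add: D_def less_le)
      have "D x * (1 + (g x - ln (D x))) \<le> D x * exp (g x - ln (D x))"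
        using D by (intro mult_left_mono exp_ge_add_one_self) auto
      also have "\<dots> = exp (g x)" using D by (simp add: exp_diff)
      finally show ?thesis by (simp add: h_eq algebra_simps)
    qed simp
  qed (use int eg in auto)
  also have "\<dots> = (\<integral>x. D x * ?h x \<partial>\<nu>) - (\<integral>x. D x * 1 \<partial>\<nu>) + (\<integral>x. exp (g x) \<partial>\<nu>)"
    using int eg by simp
  also have "\<dots> = (\<integral>x. ?h x \<partial>\<mu>) - 1 + (\<integral>x. exp (g x) \<partial>\<nu>)"
    using RN'[of ?h] RN'[of "\<lambda>_. 1"] by (simp add: D_def \<mu>.prob_space)
  finally show ?thesis using k by simp
qed

text \<open>Compared with Pinsker's inequality, the divergence enters linearly instead of under a square
  root, at the price of the factor \<open>exp 1 - 1\<close>, the most by which the exponential of an indicator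
  function exceeds 1.\<close>

lemma KL_event_bound:
  assumes "prob_space \<mu>" "prob_space \<nu>" and sets: "sets \<mu> = sets \<nu>"
    and KL: "KL \<mu> \<nu> \<le> ereal k" and A: "A \<in> sets \<nu>"
  shows "measure \<mu> A \<le> k + (exp 1 - 1) * measure \<nu> A"
proof -
  interpret \<mu>: prob_space \<mu> by fact
  interpret \<nu>: prob_space \<nu> by fact
  have A' [measurable]: "A \<in> sets \<mu>" "A \<in> sets \<nu>" using A sets by auto
  have e: "exp (indicat_real A x) = 1 + (exp 1 - 1) * indicat_real A x" for x
    by (simp add: indicator_def)
  have int_\<mu>: "integrable \<mu> (indicat_real A)" and int_\<nu>: "integrable \<nu> (indicat_real A)"
    by (auto simp: \<mu>.emeasure_finite \<nu>.emeasure_finite less_top[symmetric])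
  have "measure \<mu> A = (\<integral>x. indicat_real A x \<partial>\<mu>)"
    using A' by simp
  also have "\<dots> \<le> k + (\<integral>x. exp (indicat_real A x) \<partial>\<nu>) - 1"
    using int_\<mu> int_\<nu> by (intro KL_variational_bound assms) (auto simp: e)
  also have "(\<integral>x. exp (indicat_real A x) \<partial>\<nu>) = 1 + (exp 1 - 1) * measure \<nu> A"
  proof -
    have "(\<integral>x. indicat_real A x \<partial>\<nu>) = measure \<nu> A"
      using A' by simp
    then show ?thesis
      unfolding e
      by (subst Bochner_Integration.integral_add) (use int_\<nu> in \<open>auto simp: \<nu>.prob_space\<close>)
  qed
  finally show ?thesis by simp
qed

section \<open>The best of independent samples\<close>

text \<open>The selected value is the minimum over all samples whichever minimizing index \<open>I\<close> picks, so the
  event is an intersection of independent events of equal probability. This also settles its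
  measurability, although \<open>I\<close> itself need not be measurable.\<close>

lemma (in prob_space) prob_argmin_ge:
  assumes indep: "indep_vars (\<lambda>_. S) X {1..N}"
    and law: "\<And>i. i \<in> {1..N} \<Longrightarrow> distr M S (X i) = \<mu>"
    and f: "f \<in> borel_measurable S" and N: "N > 0"
    and I: "\<And>\<omega>. \<omega> \<in> space M \<Longrightarrow> is_arg_min (\<lambda>i. f (X i \<omega>)) (\<lambda>i. i \<in> {1..N}) (I \<omega>)"
  shows "prob {\<omega> \<in> space M. (c::real) \<le> f (X (I \<omega>) \<omega>)} = measure \<mu> {x \<in> space S. c \<le> f x} ^ N"
proof -
  let ?A = "{x \<in> space S. c \<le> f x}"
  have A: "?A \<in> sets S" using f by measurable
  have X: "X i \<in> M \<rightarrow>\<^sub>M S" if "i \<in> {1..N}" for i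
    using indep that by (auto simp: indep_vars_def)
  have "{\<omega> \<in> space M. c \<le> f (X (I \<omega>) \<omega>)} = (\<Inter>i\<in>{1..N}. X i -` ?A \<inter> space M)" (is "?E = ?F")
  proof (intro set_eqI iffI)
    fix \<omega> assume \<omega>: "\<omega> \<in> ?E"
    then have "c \<le> f (X i \<omega>)" if "i \<in> {1..N}" for i
      using I[of \<omega>] that by (force simp: is_arg_min_linorder)
    then show "\<omega> \<in> ?F"
      using \<omega> X by (auto intro: measurable_space)
  next
    fix \<omega> assume \<omega>: "\<omega> \<in> ?F"
    then have "\<omega> \<in> space M" using N by force
    then have "I \<omega> \<in> {1..N}" using I by (simp add: is_arg_min_def)
    then show "\<omega> \<in> ?E" using \<omega> \<open>\<omega> \<in> space M\<close> by blast
  qed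
  also have "prob \<dots> = (\<Prod>i\<in>{1..N}. prob (X i -` ?A \<inter> space M))"
    using indep N A by (intro indep_varsD_finite) auto
  also have "\<dots> = (\<Prod>i\<in>{1..N}. measure \<mu> ?A)"
  proof (rule prod.cong[OF refl])
    fix i assume i: "i \<in> {1..N}"
    show "prob (X i -` ?A \<inter> space M) = measure \<mu> ?A"
      using measure_distr[OF X[OF i] A] law[OF i] by simp
  qed
  finally show ?thesis by simp
qed

lemma geometric_decay:
  fixes p s \<delta> :: real
  assumes "0 \<le> p" "s \<le> 1 - p" "0 < \<delta>" "ln (1 / \<delta>) \<le> s * real N"
  shows "p ^ N \<le> \<delta>"
proof -
  have "p \<le> exp (- s)"
    using assms(2) exp_ge_add_one_self[of "- s"] by linarith
  then have "p ^ N \<le> exp (- s) ^ N"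
    using assms(1) by (intro power_mono)
  also have "\<dots> = exp (- (s * real N))"
    by (simp add: exp_of_nat_mult[symmetric] mult.commute)
  also have "\<dots> \<le> exp (ln \<delta>)"
    using assms(3,4) by (subst exp_le_cancel_iff) (simp add: ln_div)
  finally show ?thesis using assms(3) by simp
qed

section \<open>Suboptimality of the best sample\<close>

theorem theoremS5:
  fixes U :: "real^'n \<Rightarrow> real" and a0 L C a \<epsilon> \<delta> :: real and F :: "(real^'n) set"
    and N :: nat and \<mu>t :: "(real^'n) measure" and P :: "'w measure"
    and X :: "nat \<Rightarrow> 'w \<Rightarrow> real^'n" and I :: "'w \<Rightarrow> nat"
  assumes U_diff: "\<And>x. U differentiable (at x)"
    and U_diff2: "\<And>x. grad U differentiable (at x)"
    and U_smooth: "L-lipschitz_on UNIV (grad U)"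
    and hess_lipschitz: "\<exists>M. M-lipschitz_on UNIV (hess U)"
    and hess_bounded: "bounded (range (hess U))"
    and a0: "a0 > 0" "integrable lborel (\<lambda>x. exp (- a0 * U x))"
    and minimizers: "minimizers U \<noteq> {}" "finite (minimizers U)"
    and no_minimizer_at_infinity:
      "\<not> (\<exists>x :: nat \<Rightarrow> real^'n. filterlim (\<lambda>n. norm (x n)) at_top sequentially \<and>
            (\<lambda>n. U (x n)) \<longlonglongrightarrow> (INF y. U y))"
    and LSI: "\<forall>b\<ge>a0. \<exists>\<rho>>0. log_sobolev (gibbs U b) \<rho>"
    and second_moment:
      "\<exists>z\<in>minimizers U. integrable lborel (\<lambda>x. (norm (x - z))\<^sup>2 * exp (- U x))"
    and C6: "minimizers U \<subseteq> interior F" "Ck_on 6 U F"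
    and hess_pos_def: "\<And>x. x \<in> minimizers U \<Longrightarrow> pos_def (hess U x)"
    and C: "C > 0"
      "\<forall>b\<ge>a0. wasserstein2 (gibbs U b) (limit_gibbs U) \<le> ennreal (C * b powr (-1/4))"
    and \<epsilon>: "\<epsilon> \<in> {0<..<1/2}"
    and \<delta>: "\<delta> \<in> {0<..<1}"
    and a: "a \<ge> max a0 (9 * C^4 * L\<^sup>2 / \<epsilon>\<^sup>2)"
    and N: "N > 0" "real N \<ge> 18 * ln (1 / \<delta>) / \<epsilon>\<^sup>2"
    and \<mu>t: "prob_space \<mu>t" "sets \<mu>t = sets borel"
    and KL: "KL \<mu>t (gibbs U a) \<le> ereal (\<epsilon>\<^sup>2 / 18)"
    and P: "prob_space P"
    and indep: "prob_space.indep_vars P (\<lambda>_. borel) X {1..N}"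
    and law: "\<And>i. i \<in> {1..N} \<Longrightarrow> distr P borel (X i) = \<mu>t"
    and I: "\<And>\<omega>. \<omega> \<in> space P \<Longrightarrow> is_arg_min (\<lambda>i. U (X i \<omega>)) (\<lambda>i. i \<in> {1..N}) (I \<omega>)"
  shows "measure P {\<omega> \<in> space P. U (X (I \<omega>) \<omega>) - (INF y. U y) \<ge> \<epsilon>} \<le> \<delta>"
proof -
  interpret P: prob_space P by fact
  have m: "(INF y. U y) = U z'" if "z' \<in> minimizers U" for z'
    using that by (intro cInf_eq_minimum) (auto simp: minimizers_def)
  have \<epsilon>0: "0 < \<epsilon>" "\<epsilon> < 1 / 2" using \<epsilon> by auto
  have a_pos: "0 < a" "a0 \<le> a" using a a0(1) by auto
  define w where "w = C * a powr (- 1 / 4)"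
  have w: "0 \<le> w" "wasserstein2 (gibbs U a) (limit_gibbs U) \<le> ennreal w"
    using C a_pos by (auto simp: w_def)
  have "continuous_on UNIV U"
    using U_diff by (auto intro!: continuous_at_imp_continuous_on differentiable_imp_continuous_within)
  then have U_meas [measurable]: "U \<in> borel_measurable borel"
    by (rule borel_measurable_continuous_onI)

  \<comment> \<open>That the Gibbs measure has total mass one is read off from it being a marginal of a
    probability measure.\<close>
  obtain \<pi> where "\<pi> \<in> couplings (gibbs U a) (limit_gibbs U)"
    using wasserstein2_coupling[OF w(2,1), of "w\<^sup>2 + 1"] by auto
  then have \<pi>: "prob_space \<pi>" "sets \<pi> = sets (borel \<Otimes>\<^sub>M borel)" "distr \<pi> borel fst = gibbs U a"
    by (auto simp: couplings_def)
  have "fst \<in> \<pi> \<rightarrow>\<^sub>M borel"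
    unfolding measurable_cong_sets[OF \<pi>(2) refl] by measurable
  then have gibbs: "prob_space (gibbs U a)"
    using prob_space.prob_space_distr[OF \<pi>(1)] \<pi>(3) by metis
  have sets_gibbs: "sets (gibbs U a) = sets borel"
    by (simp add: gibbs_def)

  let ?A = "{x. \<epsilon> \<le> U x - (INF y. U y)}"
  have sqrt_a: "3 * C\<^sup>2 * L / \<epsilon> \<le> sqrt a"
  proof (rule real_le_rsqrt)
    have "(3 * C\<^sup>2 * L / \<epsilon>)\<^sup>2 = 9 * C^4 * L\<^sup>2 / \<epsilon>\<^sup>2"
      by (simp add: power_divide power_mult_distrib)
    then show "(3 * C\<^sup>2 * L / \<epsilon>)\<^sup>2 \<le> a" using a by simp
  qed
  have w_sq: "w\<^sup>2 * sqrt a = C\<^sup>2"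
    using a_pos by (simp add: w_def power_mult_distrib powr_half_sqrt[symmetric]
        powr_power powr_add[symmetric])
  have "3 * L * w\<^sup>2 \<le> \<epsilon>"
  proof -
    have "3 * C\<^sup>2 * L \<le> sqrt a * \<epsilon>"
      using sqrt_a \<epsilon>0 by (simp add: field_simps)
    then have "sqrt a * (3 * L * w\<^sup>2) \<le> sqrt a * \<epsilon>"
      using w_sq[symmetric] by (simp add: algebra_simps)
    then show ?thesis using a_pos by simp
  qed
  then have "L * w\<^sup>2 / (2 * \<epsilon>) \<le> 1 / 6"
    using \<epsilon>0 by (simp add: field_simps)
  then have q: "measure (gibbs U a) ?A \<le> 1 / 6"
    using suboptimality_transport_bound[OF U_diff U_smooth m[symmetric]
        AE_limit_gibbs_minimizers[OF minimizers(2)] w(2,1) \<epsilon>0(1)] by simp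

  define p where "p = measure \<mu>t ?A"
  have "p \<le> \<epsilon>\<^sup>2 / 18 + (exp 1 - 1) * measure (gibbs U a) ?A"
    unfolding p_def using \<mu>t sets_gibbs by (intro KL_event_bound gibbs KL) auto
  \<comment> \<open>The factor 2 comes from \<open>exp 1 \<le> 3\<close>.\<close>
  also have "\<dots> \<le> \<epsilon>\<^sup>2 / 18 + 2 * (1 / 6)"
    using q exp_le by (intro add_left_mono mult_mono) auto
  finally have p: "p \<le> \<epsilon>\<^sup>2 / 18 + 1 / 3" by simp
  have "\<epsilon>\<^sup>2 \<le> (1 / 2)\<^sup>2" using \<epsilon>0 by (intro power_mono) auto
  with p have p': "\<epsilon>\<^sup>2 / 18 \<le> 1 - p" by (simp add: power_divide)

  have "measure P {\<omega> \<in> space P. U (X (I \<omega>) \<omega>) - (INF y. U y) \<ge> \<epsilon>}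
      = measure P {\<omega> \<in> space P. \<epsilon> + (INF y. U y) \<le> U (X (I \<omega>) \<omega>)}"
    by (simp add: algebra_simps)
  also have "\<dots> = p ^ N"
    using P.prob_argmin_ge[OF indep law U_meas N(1) I, of "\<epsilon> + (INF y. U y)"]
    by (simp add: p_def algebra_simps)
  also have "\<dots> \<le> \<delta>"
    using N(2) \<delta> \<epsilon>0 p'
    by (intro geometric_decay[of _ "\<epsilon>\<^sup>2 / 18"]) (auto simp: p_def field_simps)
  finally show ?thesis .
qed

end
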